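(* (a) The plurifine topology $\mathcal F$ on $\mathbb C^n$ induces on every $\mathbb C$-linear subspace $L\cong\mathbb C^k$ of $\mathbb C^n$ the plurifine topology on $L$. Explicitly, for any $\mathcal F$-open set $\Omega\subset\mathbb C^n$ the intersection $L\cap\Omega$ is $\mathcal F$-open in $L$, and so is the orthogonal projection of $\Omega$ on $L$. (b) A set $\omega\subset\mathbb C^k$ is $\mathcal F$-open in $\mathbb C^k$ if and only if $\omega\times\mathbb C^{n-k}$ is $\mathcal F$-open in $\mathbb C^n$.
   Context: The plurifine topology $\mathcal F$ on $\mathbb C^n$ is the coarsest topology making all plurisubharmonic functions on $\mathbb C^n$ continuous (likewise on $\mathbb C^k$, and on a $k$-dimensional complex linear subspace $L$ via a $\mathbb C$-linear identification $L\cong\mathbb C^k$). "$\mathcal F$-open" means open in the plurifine topology of the space in question. Here $1\le k\le n$. *)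

theory Defs
  imports "HOL-Analysis.Analysis"
begin

text \<open>\<open>\<complex>\<^sup>n\<close> is \<^typ>\<open>complex ^ 'n\<close>; complex scaling is \<^term>\<open>(*s)\<close>, so the prefix \<open>vec.\<close> refers to
  notions over \<open>\<complex>\<close>.\<close>

definition usc :: "('a::topological_space \<Rightarrow> ereal) \<Rightarrow> bool" where
  "usc f \<longleftrightarrow> (\<forall>c. open {x. f x < c})"

text \<open>The Lebesgue integral with values in the extended reals, as the difference of the integrals of
  the positive and the negative part (\<^const>\<open>e2ennreal\<close> sends negative numbers to \<open>0\<close>). It is used
  only for upper semicontinuous functions \<open>< \<infinity>\<close> on compact sets; these are bounded above, so that
  the positive part has a finite integral and \<open>\<infinity> - \<infinity>\<close> does not occur.\<close>

definition ereal_integral :: "'a measure \<Rightarrow> ('a \<Rightarrow> ereal) \<Rightarrow> ereal" where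
  "ereal_integral M f =
     enn2ereal (\<integral>\<^sup>+ x. e2ennreal (f x) \<partial>M) - enn2ereal (\<integral>\<^sup>+ x. e2ennreal (- f x) \<partial>M)"

definition circle_mean :: "(complex \<Rightarrow> ereal) \<Rightarrow> complex \<Rightarrow> real \<Rightarrow> ereal" where
  "circle_mean u z r =
     ereal (1 / (2 * pi)) *
     ereal_integral (restrict_space lborel {0..2 * pi}) (\<lambda>t. u (z + of_real r * cis t))"

text \<open>The constant function \<open>-\<infinity>\<close> counts as subharmonic and as plurisubharmonic. A constant function
  has no influence on the plurifine topology.\<close>

definition subharmonic :: "(complex \<Rightarrow> ereal) \<Rightarrow> bool" where
  "subharmonic u \<longleftrightarrow>
     (\<forall>z. u z < \<infinity>) \<and> usc u \<and> (\<forall>z r. 0 < r \<longrightarrow> u z \<le> circle_mean u z r)"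

definition plurisubharmonic :: "(complex ^ 'n \<Rightarrow> ereal) \<Rightarrow> bool" where
  "plurisubharmonic f \<longleftrightarrow>
     (\<forall>z. f z < \<infinity>) \<and> usc f \<and> (\<forall>a b. subharmonic (\<lambda>\<zeta>. f (a + \<zeta> *s b)))"

definition plurifine :: "(complex ^ 'n) topology" where
  "plurifine = topology_generated_by {f -` U | f U. plurisubharmonic f \<and> open U}"

lemma plurifine_continuous:
  assumes "plurisubharmonic f"
  shows "continuous_map plurifine euclidean f"
proof -
  have "openin plurifine (f -` U)" if "open U" for U
    unfolding plurifine_def using assms that by (intro topology_generated_by_Basis) blast
  moreover from this[of UNIV] have "topspace (plurifine :: (complex ^ 'a) topology) = UNIV"
    using openin_subset by fastforce
  ultimately show ?thesis
    by (simp add: continuous_map_def vimage_def)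
qed

lemma plurifine_coarsest:
  assumes "topspace X = UNIV" and "\<And>f. plurisubharmonic f \<Longrightarrow> continuous_map X euclidean f"
    and "openin plurifine U"
  shows "openin X U"
proof -
  have "openin X B" if "B \<in> {f -` V | f V. plurisubharmonic f \<and> open V}" for B
    using that assms(1,2) by (auto simp: continuous_map_def vimage_def)
  moreover have "generate_topology_on {f -` V | f V. plurisubharmonic f \<and> open V} U"
    using assms(3) unfolding plurifine_def by (rule openin_topology_generated_by)
  ultimately show ?thesis
    using generate_topology_on_coarsest[OF istopology_openin] by blast
qed

definition linear_identification ::
    "(complex ^ 'k \<Rightarrow> complex ^ 'n) \<Rightarrow> (complex ^ 'n) set \<Rightarrow> bool" where
  "linear_identification T L \<longleftrightarrow>
     Vector_Spaces.linear (*s) (*s) T \<and> inj T \<and> range T = L"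

lemma linear_identification_exists:
  fixes L :: "(complex ^ 'n) set"
  assumes "vec.subspace L" and "vec.dim L = CARD('k::finite)"
  shows "\<exists>T :: complex ^ 'k \<Rightarrow> complex ^ 'n. linear_identification T L"
  using vec.subspace_isomorphism[of "UNIV :: (complex ^ 'k) set" L] assms
  unfolding linear_identification_def by (auto simp: card_cart_basis vec.dim_UNIV)

text \<open>The topology carried over to \<open>L\<close> by an identification \<open>T\<close>: the open sets are the images under
  \<open>T\<close> of the plurifine open sets of \<open>\<complex>\<^sup>k\<close>.\<close>

definition plurifine_on ::
    "(complex ^ 'n) set \<Rightarrow> (complex ^ 'k \<Rightarrow> complex ^ 'n) \<Rightarrow> (complex ^ 'n) topology" where
  "plurifine_on L T = pullback_topology L (inv T) plurifine"

lemma openin_plurifine_on: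
  assumes "linear_identification T L"
  shows "openin (plurifine_on L T) S \<longleftrightarrow> (\<exists>U. openin plurifine U \<and> S = T ` U)"
proof -
  have "inv T -` U \<inter> L = T ` U" for U
    using assms unfolding linear_identification_def by (auto simp: inv_f_f)
  then show ?thesis
    unfolding plurifine_on_def openin_pullback_topology by simp
qed

definition hermitian_inner :: "complex ^ 'n \<Rightarrow> complex ^ 'n \<Rightarrow> complex" where
  "hermitian_inner x y = (\<Sum>i\<in>UNIV. x $ i * cnj (y $ i))"

definition orthogonal_projection :: "(complex ^ 'n) set \<Rightarrow> complex ^ 'n \<Rightarrow> complex ^ 'n" where
  "orthogonal_projection L z = (THE p. p \<in> L \<and> (\<forall>w\<in>L. hermitian_inner (z - p) w = 0))"

text \<open>\<open>\<omega> \<times> \<complex>\<^bsup>n-k\<^esup>\<close>, where the injection \<open>\<iota>\<close> of index types says which \<open>k\<close> of the \<open>n\<close> coordinates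
  are those of the factor \<open>\<complex>\<^sup>k\<close>. The remaining coordinates are free; for bijective \<open>\<iota>\<close> there are
  none.\<close>

definition cylinder :: "('k \<Rightarrow> 'n) \<Rightarrow> (complex ^ 'k) set \<Rightarrow> (complex ^ 'n) set" where
  "cylinder \<iota> \<omega> = {z. (\<chi> i. z $ \<iota> i) \<in> \<omega>}"

lemma hermitian_inner_Re: "Re (hermitian_inner x y) = x \<bullet> y"
  by (simp add: hermitian_inner_def inner_vec_def inner_complex_def)

lemma hermitian_inner_Im: "Im (hermitian_inner x y) = x \<bullet> (\<i> *s y)"
  by (simp add: hermitian_inner_def inner_vec_def inner_complex_def algebra_simps)

lemma orthogonal_projection_ex1:
  assumes "vec.subspace L"
  shows "\<exists>!p. p \<in> L \<and> (\<forall>w\<in>L. hermitian_inner (z - p) w = 0)"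
proof (rule ex_ex1I)
  have smul: "c *\<^sub>R x = complex_of_real c *s x" for c and x :: "complex ^ 'a"
    by (simp add: vec_eq_iff scaleR_conv_of_real[where x = "_ :: complex"])
  have sub: "subspace L"
    using assms unfolding subspace_def vec.subspace_def smul by blast
  obtain p q where p: "p \<in> span L" and q: "\<And>w. w \<in> span L \<Longrightarrow> orthogonal q w" and z: "z = p + q"
    using orthogonal_subspace_decomp_exists[of L z] by blast
  have "hermitian_inner (z - p) w = 0" if "w \<in> L" for w
  proof (rule complex_eqI)
    have "\<i> *s w \<in> L"
      using assms that by (rule vec.subspace_scale)
    then show "Im (hermitian_inner (z - p) w) = Im 0"
      using q[of "\<i> *s w"] by (simp add: hermitian_inner_Im z orthogonal_def span_base)
    show "Re (hermitian_inner (z - p) w) = Re 0"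
      using q[of w] that by (simp add: hermitian_inner_Re z orthogonal_def span_base)
  qed
  moreover have "p \<in> L"
    using p sub by (simp add: span_eq_iff[THEN iffD2])
  ultimately show "\<exists>p. p \<in> L \<and> (\<forall>w\<in>L. hermitian_inner (z - p) w = 0)"
    by blast
next
  fix p p'
  assume *: "p \<in> L \<and> (\<forall>w\<in>L. hermitian_inner (z - p) w = 0)"
    "p' \<in> L \<and> (\<forall>w\<in>L. hermitian_inner (z - p') w = 0)"
  then have "p - p' \<in> L"
    using assms vec.subspace_diff by blast
  then have "(z - p) \<bullet> (p - p') = 0" "(z - p') \<bullet> (p - p') = 0"
    using * by (metis hermitian_inner_Re zero_complex.sel(1))+
  then have "(p - p') \<bullet> (p - p') = 0"
    by (simp add: inner_diff_left)
  then show "p = p'"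
    by simp
qed

end

theory Submission
  imports Defs
begin

text \<open>Plurisubharmonicity is preserved by composition with complex affine maps, so these are
  continuous for the plurifine topologies. Both parts follow, because an injective linear map has a
  linear left inverse, and the projection of \<open>\<Omega>\<close> on \<open>L\<close> is the union of the sets \<open>L \<inter> (\<Omega> - v)\<close> over
  all \<open>v\<close> orthogonal to \<open>L\<close>.\<close>

text \<open>By convention the constant \<open>-\<infinity>\<close> is plurisubharmonic, so its
  preimage of \<open>UNIV\<close> is a subbasic set.\<close>

lemma topspace_plurifine [simp]: "topspace (plurifine :: (complex ^ 'n) topology) = UNIV"
proof -
  have "plurisubharmonic (\<lambda>z :: complex ^ 'n. -\<infinity>)"
    by (auto simp: plurisubharmonic_def subharmonic_def usc_def)
  then have "openin plurifine ((\<lambda>z :: complex ^ 'n. -\<infinity> :: ereal) -` UNIV)"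
    unfolding plurifine_def by (intro topology_generated_by_Basis) blast
  then show ?thesis
    using openin_subset by fastforce
qed

text \<open>An affine map sends the line through \<open>a\<close> in direction \<open>b\<close> to
  the one through \<open>c + A *v a\<close> in direction \<open>A *v b\<close>. The case
  \<open>A *v b = 0\<close> needs no separate treatment, because \<open>plurisubharmonic\<close>
  quantifies over all directions, zero included.\<close>

lemma plurisubharmonic_affine:
  fixes A :: "complex ^ 'm ^ 'n" and c :: "complex ^ 'n"
  assumes "plurisubharmonic f"
  shows "plurisubharmonic (\<lambda>z. f (c + A *v z))"
proof -
  have cont: "continuous_on UNIV (\<lambda>z. c + A *v z)"
    unfolding matrix_vector_mult_def by (intro continuous_intros)
  have "open {z. f (c + A *v z) < r}" for r
    using open_vimage[OF _ cont, of "{x. f x < r}"] assms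
    by (simp add: plurisubharmonic_def usc_def vimage_def)
  moreover have "subharmonic (\<lambda>\<zeta>. f (c + A *v (a + \<zeta> *s b)))" for a b
  proof -
    have "c + A *v (a + \<zeta> *s b) = (c + A *v a) + \<zeta> *s (A *v b)" for \<zeta>
      by (simp add: matrix_vector_right_distrib vector_scalar_commute add.assoc)
    then show ?thesis
      using assms unfolding plurisubharmonic_def by presburger
  qed
  ultimately show ?thesis
    using assms by (simp add: plurisubharmonic_def usc_def)
qed

lemma continuous_map_plurifine_affine:
  fixes A :: "complex ^ 'm ^ 'n"
  shows "continuous_map plurifine plurifine (\<lambda>z. c + A *v z)"
  unfolding plurifine_def[where 'n = 'n]
proof (rule continuous_on_generated_topo)
  fix W :: "(complex ^ 'n) set"
  assume "W \<in> {f -` U | f U. plurisubharmonic f \<and> open U}"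
  then obtain f U where f: "plurisubharmonic f" "open U" "W = f -` U"
    by blast
  show "openin plurifine ((\<lambda>z. c + A *v z) -` W \<inter> topspace plurifine)"
    using plurifine_continuous[OF plurisubharmonic_affine[OF f(1), of c A]] f(2,3)
    by (simp add: continuous_map_def vimage_def)
next
  \<comment> \<open>The union of the subbasis is the topspace, hence everything.\<close>
  show "(\<lambda>z. c + A *v z) ` topspace plurifine \<subseteq> \<Union> {f -` U | f U. plurisubharmonic f \<and> open U}"
    using topspace_plurifine[where 'n = 'n] unfolding plurifine_def topology_generated_by_topspace
    by (metis subset_UNIV)
qed

lemma openin_plurifine_affine_vimage:
  fixes A :: "complex ^ 'm ^ 'n"
  assumes "openin plurifine U"
  shows "openin plurifine {z. c + A *v z \<in> U}"
  using openin_continuous_map_preimage[OF continuous_map_plurifine_affine assms] by simp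

text \<open>Relatively open sets are pulled back along \<open>T\<close>; conversely, open sets of
  the model space are pulled back along a left inverse of \<open>T\<close>, which is defined on the
  whole ambient space and so yields the required open extension.\<close>

lemma subtopology_plurifine:
  fixes L :: "(complex ^ 'n) set" and T :: "complex ^ 'k \<Rightarrow> complex ^ 'n"
  assumes "linear_identification T L"
  shows "subtopology plurifine L = plurifine_on L T"
proof -
  define A where "A = matrix T"
  have T: "T = (*v) A" "inj ((*v) A)" "range ((*v) A) = L"
    using assms matrix_works[of T] unfolding A_def linear_identification_def
    by (auto simp: fun_eq_iff inj_def image_def)
  obtain B where "B ** A = mat 1"
    using T(2) unfolding matrix_left_invertible_injective[symmetric] by blast
  then have BA: "B *v (A *v x) = x" for x
    by (simp add: matrix_vector_mul_assoc)
  have "openin (subtopology plurifine L) S \<longleftrightarrow> openin (plurifine_on L T) S" for S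
    unfolding openin_plurifine_on[OF assms] openin_subtopology
  proof safe
    fix \<Omega> :: "(complex ^ 'n) set"
    assume \<Omega>: "openin plurifine \<Omega>"
    \<comment> \<open>The summand \<open>0\<close> gives the set the shape of
      \<open>openin_plurifine_affine_vimage\<close>.\<close>
    have "\<Omega> \<inter> L = T ` {x. 0 + A *v x \<in> \<Omega>}"
      using T by auto
    then show "\<exists>U. openin plurifine U \<and> \<Omega> \<inter> L = T ` U"
      using openin_plurifine_affine_vimage[OF \<Omega>] by blast
  next
    fix U :: "(complex ^ 'k) set"
    assume U: "openin plurifine U"
    \<comment> \<open>A point of \<open>L\<close> has the form \<open>A *v x\<close>, and
      \<open>B\<close> recovers \<open>x\<close> from it.\<close>
    have "T ` U = {z. 0 + B *v z \<in> U} \<inter> L"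
      using T by (auto simp: BA)
    then show "\<exists>\<Omega>. openin plurifine \<Omega> \<and> T ` U = \<Omega> \<inter> L"
      using openin_plurifine_affine_vimage[OF U] by blast
  qed
  then show ?thesis
    by (simp add: topology_eq)
qed

lemma orthogonal_projection_eqI:
  assumes "vec.subspace L" "p \<in> L" "\<And>w. w \<in> L \<Longrightarrow> hermitian_inner (z - p) w = 0"
  shows "orthogonal_projection L z = p"
  unfolding orthogonal_projection_def
  using orthogonal_projection_ex1[OF assms(1)] assms(2,3) by (intro the1_equality) auto

lemma orthogonal_projection_image:
  assumes "vec.subspace L"
  shows "orthogonal_projection L ` \<Omega> =
    (\<Union>v \<in> {v. \<forall>w\<in>L. hermitian_inner v w = 0}. L \<inter> {p. v + p \<in> \<Omega>})"
proof safe
  fix z assume "z \<in> \<Omega>"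
  obtain p where p: "p \<in> L" "\<forall>w\<in>L. hermitian_inner (z - p) w = 0"
    using orthogonal_projection_ex1[OF assms] by blast
  then have "orthogonal_projection L z = p"
    using assms by (intro orthogonal_projection_eqI) auto
  with p \<open>z \<in> \<Omega>\<close> show "orthogonal_projection L z \<in>
      (\<Union>v \<in> {v. \<forall>w\<in>L. hermitian_inner v w = 0}. L \<inter> {p. v + p \<in> \<Omega>})"
    \<comment> \<open>The index of the union is the component of \<open>z\<close> orthogonal to
      \<open>L\<close>.\<close>
    by (auto intro!: bexI[of _ "z - p"])
next
  fix v p assume "\<forall>w\<in>L. hermitian_inner v w = 0" "p \<in> L" "v + p \<in> \<Omega>"
  moreover from this have "orthogonal_projection L (v + p) = p"
    using assms by (intro orthogonal_projection_eqI) auto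
  ultimately show "p \<in> orthogonal_projection L ` \<Omega>"
    by (metis imageI)
qed

lemma openin_orthogonal_projection:
  assumes "vec.subspace L" "openin plurifine \<Omega>"
  shows "openin (subtopology plurifine L) (orthogonal_projection L ` \<Omega>)"
proof -
  have "openin plurifine {p. v + p \<in> \<Omega>}" for v
    \<comment> \<open>Translation by \<open>v\<close> is the affine map with identity
      matrix.\<close>
    using openin_plurifine_affine_vimage[OF assms(2), of v "mat 1"] by simp
  then show ?thesis
    unfolding orthogonal_projection_image[OF assms(1)]
    by (intro openin_Union) (auto simp: openin_subtopology_Int2)
qed

lemma openin_plurifine_cylinder_iff:
  fixes \<iota> :: "'k::finite \<Rightarrow> 'n::finite"
  assumes "inj \<iota>"
  shows "openin plurifine (cylinder \<iota> \<omega>) \<longleftrightarrow> openin plurifine \<omega>"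
proof
  \<comment> \<open>\<open>?P\<close> selects the coordinates indexed by \<open>\<iota>\<close>, so
    the cylinder is the preimage of \<open>\<omega>\<close> under it.\<close>
  let ?P = "(\<chi> i j. if j = \<iota> i then 1 else 0) :: complex ^ 'n ^ 'k"
  have P: "?P *v z = (\<chi> i. z $ \<iota> i)" for z
    by (simp add: matrix_vector_mult_def if_distrib[of "\<lambda>x. x * _"] cong: if_cong)
  show "openin plurifine (cylinder \<iota> \<omega>)" if "openin plurifine \<omega>"
    using openin_plurifine_affine_vimage[OF that, of 0 ?P] by (simp add: P cylinder_def)
  \<comment> \<open>\<open>?E\<close> puts \<open>x\<close> into the coordinates
    \<open>\<iota> i\<close> and zero elsewhere. Injectivity of \<open>\<iota>\<close> makes it a
    section of \<open>?P\<close>, so the preimage of the cylinder under \<open>?E\<close> is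
    \<open>\<omega>\<close>.\<close>
  let ?E = "(\<chi> j i. if j = \<iota> i then 1 else 0) :: complex ^ 'k ^ 'n"
  have "(?E *v x) $ \<iota> i = x $ i" for x i
    using assms
    by (simp add: matrix_vector_mult_def inj_eq if_distrib[of "\<lambda>x. x * _"] cong: if_cong)
  then show "openin plurifine \<omega>" if "openin plurifine (cylinder \<iota> \<omega>)"
    using openin_plurifine_affine_vimage[OF that, of 0 ?E] by (simp add: cylinder_def)
qed

theorem lemma2p1:
  shows
    "(\<forall>(L :: (complex ^ 'n) set) (T :: complex ^ 'k \<Rightarrow> complex ^ 'n).
        vec.subspace L \<and> vec.dim L = CARD('k) \<and> linear_identification T L \<longrightarrow>
          subtopology plurifine L = plurifine_on L T \<and>
          (\<forall>\<Omega>. openin plurifine \<Omega> \<longrightarrow>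
             openin (plurifine_on L T) (L \<inter> \<Omega>) \<and>
             openin (plurifine_on L T) (orthogonal_projection L ` \<Omega>)))
     \<and>
     (\<forall>(\<iota> :: 'k \<Rightarrow> 'n) (\<omega> :: (complex ^ 'k) set).
        inj \<iota> \<longrightarrow> (openin plurifine \<omega> \<longleftrightarrow> openin plurifine (cylinder \<iota> \<omega>)))"
  \<comment> \<open>Read from right to left, \<open>subtopology_plurifine\<close> turns openness in
    \<open>plurifine_on L T\<close> into relative openness in \<open>L\<close>.\<close>
  by (auto simp: subtopology_plurifine[symmetric] openin_subtopology_Int2
      openin_orthogonal_projection openin_plurifine_cylinder_iff)

end
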